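(* Let $f,g:(0,\infty)\to\mathbb{R}$ be convex functions with $f(1)=g(1)=0$. Then every $(f,g)$-achievable point is a convex combination of two $(f,g)$-achievable points that are $2$-achievable. Consequently, every $(f,g)$-achievable point is $4$-achievable.
   Context: For a convex function $f:(0,\infty)\to\mathbb{R}$ with $f(1)=0$, set $f(0)=\lim_{t\to0}f(t)$, $f^{\ast}(t)=tf(t^{-1})$ and $f^{\ast}(0)=\lim_{t\to\infty}f(t)/t$. If $P,Q$ are probability measures absolutely continuous with respect to a measure $\mu$ with densities $p=dP/d\mu$, $q=dQ/d\mu$, the $f$-divergence is $D_f(P,Q)=\int_{\{q>0\}} f(p/q)\,dQ+f^{\ast}(0)\,P(q=0)$. A point $(x,y)\in\mathbb{R}^2$ is $(f,g)$-achievable if there exist probability measures $P,Q$ on some common measurable space ($\sigma$-algebra) with $(x,y)=(D_f(P,Q),D_g(P,Q))$. A point $(x,y)$ is $d$-achievable if there exist probability vectors $P,Q\in\mathbb{R}^d$ (distributions on a $d$-element set) with $(x,y)=(D_f(P,Q),D_g(P,Q))$. *)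

theory Defs
  imports "HOL-Probability.Probability"
begin

definition fzero :: "(real \<Rightarrow> real) \<Rightarrow> ereal" where
  "fzero f = Lim (at_right 0) (\<lambda>t. ereal (f t))"

definition fstar0 :: "(real \<Rightarrow> real) \<Rightarrow> ereal" where
  "fstar0 f = Lim at_top (\<lambda>t. ereal (f t / t))"

definition fext :: "(real \<Rightarrow> real) \<Rightarrow> real \<Rightarrow> ereal" where
  "fext f t = (if t > 0 then ereal (f t) else fzero f)"

definition eint :: "'a measure \<Rightarrow> ('a \<Rightarrow> ereal) \<Rightarrow> ereal" where
  "eint M h = enn2ereal (\<integral>\<^sup>+ x. e2ennreal (h x) \<partial>M)
             - enn2ereal (\<integral>\<^sup>+ x. e2ennreal (- h x) \<partial>M)"

definition is_density :: "'a measure \<Rightarrow> ('a \<Rightarrow> real) \<Rightarrow> bool" where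
  "is_density M p \<longleftrightarrow> p \<in> borel_measurable M \<and> (\<forall>x\<in>space M. 0 \<le> p x)
      \<and> (\<integral>\<^sup>+ x. ennreal (p x) \<partial>M) = 1"

text \<open>D_f(P,Q) = int_{q>0} f(p/q) dQ + f*(0) P(q=0), where P = p mu, Q = q mu.\<close>
definition fdiv :: "(real \<Rightarrow> real) \<Rightarrow> 'a measure \<Rightarrow> ('a \<Rightarrow> real) \<Rightarrow> ('a \<Rightarrow> real) \<Rightarrow> ereal" where
  "fdiv f M p q =
     eint (density M (\<lambda>x. ennreal (q x)))
          (\<lambda>x. if q x > 0 then fext f (p x / q x) else 0)
     + fstar0 f * ereal (measure (density M (\<lambda>x. ennreal (p x))) {x \<in> space M. q x = 0})"

definition fg_achievable :: "'a itself \<Rightarrow> (real \<Rightarrow> real) \<Rightarrow> (real \<Rightarrow> real) \<Rightarrow> real \<Rightarrow> real \<Rightarrow> bool" where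
  "fg_achievable _ f g x y \<longleftrightarrow>
     (\<exists>(M::'a measure) p q. is_density M p \<and> is_density M q \<and>
        fdiv f M p q = ereal x \<and> fdiv g M p q = ereal y)"

definition d_achievable :: "nat \<Rightarrow> (real \<Rightarrow> real) \<Rightarrow> (real \<Rightarrow> real) \<Rightarrow> real \<Rightarrow> real \<Rightarrow> bool" where
  "d_achievable d f g x y \<longleftrightarrow>
     (\<exists>p q :: nat \<Rightarrow> real. (\<forall>i<d. 0 \<le> p i \<and> 0 \<le> q i) \<and>
        (\<Sum>i<d. p i) = 1 \<and> (\<Sum>i<d. q i) = 1 \<and>
        fdiv f (count_space {..<d}) p q = ereal x \<and>
        fdiv g (count_space {..<d}) p q = ereal y)"

end

theory Submission
  imports Defs
begin

text \<open>
  With \<open>\<nu> = (P + Q) / 2\<close> and \<open>S = (q - p) / (q + p)\<close>, which takes values in \<open>[-1, 1]\<close> and has mean 0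
  under \<open>\<nu>\<close>, one has \<open>D_f(P, Q) = E F(S)\<close> for \<open>F(s) = (1 + s) f((1 - s) / (1 + s))\<close>, extended
  to \<open>\<plusminus>1\<close> by its limits; likewise \<open>D_g(P, Q) = E G(S)\<close>. Binary pairs correspond to mean-zero
  distributions on two points \<open>a \<le> 0 \<le> b\<close>, so their points form the continuous image of a convex set
  of pairs \<open>(a, b)\<close>: a connected planar set \<open>A\<close>. If \<open>z = (E F(S), E G(S))\<close> were on no segment
  with endpoints in \<open>A\<close>, then \<open>A\<close>, seen from \<open>z\<close>, would span an angle of at most \<open>\<pi>\<close> and miss
  one of the two extreme directions if it is equal to \<open>\<pi>\<close>. Hence \<open>A\<close> would be strictly positive for a
  lexicographic pair of linear functionals. For each functional in turn, a supporting line through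
  the origin forces equality almost surely, which contradicts the strictness. Mixing two binary
  pairs on disjoint supports gives a pair on four points.
\<close>

section \<open>Connected planar sets seen from the origin\<close>

text \<open>After division by a point of \<open>A\<close> the set avoids the nonpositive real axis,
  so \<open>Arg\<close> is continuous on it and its values form an interval \<open>I\<close>. No two
  of them differ by pi or more, so \<open>I\<close> has length at most pi and lacks an end if the
  length is pi. Multiplication by \<open>u\<close> turns the middle of \<open>I\<close> to the
  positive real axis; \<open>v\<close> breaks the tie at the end that may be attained.\<close>

lemma connected_lexicographic_half_plane:
  fixes A :: "complex set"
  assumes conn: "connected A" and "A \<noteq> {}"
    and seg: "\<And>a b. a \<in> A \<Longrightarrow> b \<in> A \<Longrightarrow> 0 \<notin> closed_segment a b"
  shows "\<exists>u v. \<forall>w\<in>A. 0 \<le> Re (u * w) \<and> (Re (u * w) = 0 \<longrightarrow> 0 < Re (v * w))"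
proof -
  obtain a where a: "a \<in> A" using \<open>A \<noteq> {}\<close> by blast
  have nz: "w \<noteq> 0" if "w \<in> A" for w using seg[OF that that] by auto
  have opp: "w \<noteq> - of_real r * z" if "w \<in> A" "z \<in> A" "r \<ge> 0" for w z r
  proof
    assume eq: "w = - of_real r * z"
    \<comment> \<open>This weight solves \<open>1 - t = t * r\<close>, so it places 0 on the segment
      from \<open>z\<close> to \<open>w\<close>.\<close>
    define t where "t = 1 / (1 + r)"
    have t: "0 \<le> t" "t \<le> 1" "(1 - t) - t * r = 0"
      using \<open>r \<ge> 0\<close> by (auto simp: t_def field_simps)
    have "(1 - t) *\<^sub>R z + t *\<^sub>R w = ((1 - t) - t * r) *\<^sub>R z"
      by (simp add: eq scaleR_conv_of_real algebra_simps)
    then have "0 \<in> closed_segment z w"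
      unfolding closed_segment_def using t by (auto intro!: exI[of _ t])
    then show False using seg that by blast
  qed
  define B where "B = (\<lambda>w. w / a) ` A"
  have Bne: "\<And>z. z \<in> B \<Longrightarrow> z \<notin> \<real>\<^sub>\<le>\<^sub>0"
  proof
    fix z assume "z \<in> B" "z \<in> \<real>\<^sub>\<le>\<^sub>0"
    then obtain w r where w: "w \<in> A" "w / a = of_real r" "r \<le> 0"
      by (auto simp: B_def nonpos_Reals_def)
    then have "w = - of_real (- r) * a" using nz[OF a] by (simp add: field_simps)
    then show False using opp[OF w(1) a, of "-r"] w(3) by simp
  qed
  define I where "I = Arg ` B"
  have "connected B" unfolding B_def
    using nz[OF a] by (intro connected_continuous_image conn continuous_intros) auto
  then have Iconn: "connected I" unfolding I_def
    by (intro connected_continuous_image continuous_on_subset[OF continuous_on_Arg]) (use Bne in auto)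
  have "1 \<in> B" unfolding B_def using a nz[OF a] by (auto intro!: image_eqI[of _ _ a])
  then have I0: "0 \<in> I" unfolding I_def using Arg_1 by (metis imageI)
  have polar: "w / a = of_real (cmod (w / a)) * cis (Arg (w / a))" if "w \<in> A" for w
    using nz[OF that] nz[OF a] Arg_eq[of "w / a"] by (simp add: cis_conv_exp)
  have diff: "\<theta>2 - \<theta>1 < pi" if "\<theta>1 \<in> I" "\<theta>2 \<in> I" for \<theta>1 \<theta>2
  proof (rule ccontr)
    assume "\<not> \<theta>2 - \<theta>1 < pi"
    \<comment> \<open>By connectedness a gap of pi or more yields an argument exactly pi beyond
      \<open>\<theta>1\<close>, that is, two points of \<open>A\<close> on opposite rays, against
      \<open>opp\<close>.\<close>
    then have "\<theta>1 + pi \<in> {\<theta>1..\<theta>2}" by simp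
    then have "\<theta>1 + pi \<in> I" using connected_contains_Icc[OF Iconn that] by blast
    with that obtain w z where w: "w \<in> A" "Arg (w / a) = \<theta>1 + pi" and z: "z \<in> A" "Arg (z / a) = \<theta>1"
      by (auto simp: I_def B_def)
    define k where "k = cmod (w / a) / cmod (z / a)"
    have "cmod (z / a) \<noteq> 0" using nz z a by simp
    then have "of_real (cmod (w / a)) = of_real k * (of_real (cmod (z / a)) :: complex)"
      unfolding k_def of_real_mult[symmetric] by simp
    then have "w / a = of_real k * (of_real (cmod (z / a)) * - cis \<theta>1)"
      using polar[OF w(1)] unfolding w(2) by (simp add: cis_mult[symmetric])
    also have "\<dots> = - of_real k * (z / a)"
      using polar[OF z(1)] unfolding z(2) by simp
    finally have "w = - of_real k * z" using nz[OF a] by (simp add: field_simps)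
    moreover have "k \<ge> 0" by (simp add: k_def)
    ultimately show False using opp[OF w(1) z(1)] by blast
  qed
  have bdd: "bdd_above I" "bdd_below I"
    unfolding I_def using Arg_le_pi mpi_less_Arg less_imp_le by (meson bdd_above.I2 bdd_below.I2)+
  define M N m where "M = Sup I" and "N = Inf I" and "m = (Sup I + Inf I) / 2"
  have up: "\<theta> \<le> M" and lo: "N \<le> \<theta>" if "\<theta> \<in> I" for \<theta>
    using that bdd by (auto simp: M_def N_def intro: cSup_upper cInf_lower)
  have "M - pi \<le> \<theta>" if "\<theta> \<in> I" for \<theta>
    using cSup_least[of I "\<theta> + pi"] I0 diff[OF that] unfolding M_def by (force simp: less_imp_le)
  then have MN: "M - N \<le> pi"
    using cInf_greatest[of I "M - pi"] I0 unfolding N_def by force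
  have m: "m = (M + N) / 2" by (simp add: m_def M_def N_def)
  define u where "u = cis (- m) / a"
  \<comment> \<open>\<open>Re (u * w)\<close> can vanish only at an end of \<open>I\<close>, and
    only if \<open>M - N = pi\<close>. Then at most one end is attained, and \<open>\<sigma>\<close>
    is the sign of the sine there.\<close>
  define \<sigma> :: real where "\<sigma> = (if M \<in> I then 1 else -1)"
  define v where "v = - \<i> * of_real \<sigma> * u"
  show ?thesis
  proof (rule exI[of _ u], rule exI[of _ v], rule ballI)
    fix w assume w: "w \<in> A"
    define \<theta> where "\<theta> = Arg (w / a)"
    have \<theta>: "\<theta> \<in> I" using w by (auto simp: \<theta>_def I_def B_def)
    have "u * w = cis (- m) * (w / a)" by (simp add: u_def)
    also have "\<dots> = of_real (cmod (w / a)) * (cis (- m) * cis \<theta>)"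
      by (subst polar[OF w]) (simp add: \<theta>_def)
    also have "\<dots> = of_real (cmod (w / a)) * cis (\<theta> - m)"
      by (simp add: cis_mult)
    finally have uw: "u * w = of_real (cmod (w / a)) * cis (\<theta> - m)" .
    have pos: "cmod (w / a) > 0" using nz w a by simp
    have Re_u: "Re (u * w) = cmod (w / a) * cos (\<theta> - m)" unfolding uw by simp
    have "v * w = - \<i> * of_real \<sigma> * (u * w)" by (simp add: v_def)
    then have Re_v: "Re (v * w) = cmod (w / a) * (\<sigma> * sin (\<theta> - m))"
      unfolding uw by simp
    have range: "- (pi / 2) \<le> \<theta> - m" "\<theta> - m \<le> pi / 2"
      using up[OF \<theta>] lo[OF \<theta>] MN by (auto simp: m field_simps)
    have "0 < \<sigma> * sin (\<theta> - m)" if "cos (\<theta> - m) = 0"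
    proof -
      have "\<theta> - m = pi / 2 \<or> \<theta> - m = - (pi / 2)"
        using range that cos_gt_zero_pi[of "\<theta> - m"] by fastforce
      then show ?thesis
      proof
        assume eq: "\<theta> - m = pi / 2"
        then have "\<theta> = M" using up[OF \<theta>] MN by (simp add: m field_simps)
        then have "M \<in> I" using \<theta> by simp
        then show ?thesis unfolding eq by (simp add: \<sigma>_def)
      next
        assume eq: "\<theta> - m = - (pi / 2)"
        then have "M - \<theta> = pi" using lo[OF \<theta>] MN by (simp add: m field_simps)
        then have "M \<notin> I" using diff[OF \<theta>, of M] by auto
        then show ?thesis unfolding eq by (simp add: \<sigma>_def)
      qed
    qed
    then show "0 \<le> Re (u * w) \<and> (Re (u * w) = 0 \<longrightarrow> 0 < Re (v * w))"
      unfolding Re_u Re_v using pos cos_ge_zero[OF range] by auto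
  qed
qed

section \<open>Supporting lines and mean-zero random variables\<close>

text \<open>For \<open>a < 0 < b\<close>, division of \<open>le\<close> by \<open>a * b\<close> says
  that the slope \<open>H a / a\<close> is at most \<open>H b / b\<close>. Hence the supremum of the
  left slopes separates the two families. If 0 lies in \<open>D\<close>, \<open>le\<close> with
  \<open>a = 0\<close> gives \<open>0 \<le> H 0\<close>.\<close>

lemma slope_through_origin:
  fixes D :: "real set" and H :: "real \<Rightarrow> real"
  assumes "a0 \<in> D" "a0 < 0" "b0 \<in> D" "0 < b0"
    and le: "\<And>a b. a \<in> D \<Longrightarrow> b \<in> D \<Longrightarrow> a \<le> 0 \<Longrightarrow> 0 \<le> b \<Longrightarrow> a < b \<Longrightarrow> 0 \<le> b * H a - a * H b"
  shows "\<exists>c. \<forall>s\<in>D. c * s \<le> H s"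
proof -
  let ?L = "(\<lambda>a. H a / a) ` {a \<in> D. a < 0}"
  have key: "H a / a \<le> H b / b" if "a \<in> D" "b \<in> D" "a < 0" "0 < b" for a b
    using le[of a b] that by (simp add: field_simps)
  have ne: "?L \<noteq> {}" using assms by auto
  have bdd: "bdd_above ?L" using key assms by (intro bdd_aboveI[of _ "H b0 / b0"]) auto
  have "Sup ?L * s \<le> H s" if s: "s \<in> D" for s
  proof (cases s "0::real" rule: linorder_cases)
    case less
    then have "H s / s \<le> Sup ?L" using s bdd by (intro cSup_upper) auto
    then show ?thesis using less by (simp add: field_simps)
  next
    case equal
    then show ?thesis using le[of s b0] s assms by (simp add: zero_le_mult_iff)
  next
    case greater
    then have "Sup ?L \<le> H s / s" using s key ne by (intro cSup_least) auto
    then show ?thesis using greater by (simp add: field_simps)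
  qed
  then show ?thesis by blast
qed

lemma AE_eq_if_integral_eq:
  fixes X Y :: "'a \<Rightarrow> real"
  assumes "integrable M X" "integrable M Y" "AE x in M. X x \<le> Y x"
    and "integral\<^sup>L M X = integral\<^sup>L M Y"
  shows "AE x in M. Y x = X x"
proof -
  have "AE x in M. Y x - X x = 0"
    using assms by (subst integral_nonneg_eq_0_iff_AE[symmetric]) auto
  then show ?thesis by eventually_elim simp
qed

text \<open>A variable of constant sign with mean zero vanishes almost everywhere. The lemma is
  applied to shrinking sets \<open>D\<close>, the sets of contact with successive supporting
  lines.\<close>

lemma centred_support_both_signs:
  fixes S :: "'a \<Rightarrow> real"
  assumes S: "integrable M S" "integral\<^sup>L M S = 0" and D: "AE x in M. S x \<in> D"
    and nz: "\<not> (AE x in M. S x = 0)"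
  obtains a b where "a \<in> D" "a < 0" "b \<in> D" "0 < b"
proof -
  have 1: "\<exists>a\<in>D. a < 0"
  proof (rule ccontr)
    assume "\<not> (\<exists>a\<in>D. a < 0)"
    then have "AE x in M. 0 \<le> S x" using D by (auto elim!: eventually_mono simp: not_less)
    then show False using S nz by (simp add: integral_nonneg_eq_0_iff_AE)
  qed
  have 2: "\<exists>a\<in>D. 0 < a"
  proof (rule ccontr)
    assume "\<not> (\<exists>a\<in>D. 0 < a)"
    then have "AE x in M. 0 \<le> - S x" using D by (auto elim!: eventually_mono simp: not_less)
    then show False using S nz integral_nonneg_eq_0_iff_AE[of M "\<lambda>x. - S x"] by simp
  qed
  show ?thesis using 1 2 that by blast
qed

text \<open>The mean of \<open>h\<close> under the mean-zero distribution on \<open>{a, b}\<close>, where \<open>a \<le> 0 \<le> b\<close>.\<close>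
definition chord_at_0 :: "(real \<Rightarrow> 'b::real_vector) \<Rightarrow> real \<Rightarrow> real \<Rightarrow> 'b" where
  "chord_at_0 h a b = (b / (b - a)) *\<^sub>R h a + (- a / (b - a)) *\<^sub>R h b"

text \<open>In the application \<open>h\<close> is the pair of integrands minus the target point, so
  that 0 stands for the target and the chords for the points of binary pairs.\<close>

lemma (in prob_space) zero_on_segment_of_chords:
  fixes h :: "real \<Rightarrow> complex" and S :: "'a \<Rightarrow> real"
  assumes D: "convex D" "b0 \<in> D" "0 < b0" and h: "continuous_on D h"
    and S: "integrable M S" "expectation S = 0" "AE x in M. S x \<in> D"
    and hS: "integrable M (\<lambda>x. h (S x))" "expectation (\<lambda>x. h (S x)) = 0"
  shows "\<exists>a b a' b'. {a, b, a', b'} \<subseteq> D \<and> a \<le> 0 \<and> 0 \<le> b \<and> a < b \<and> a' \<le> 0 \<and> 0 \<le> b' \<and> a' < b'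
    \<and> 0 \<in> closed_segment (chord_at_0 h a b) (chord_at_0 h a' b')"
proof (rule ccontr)
  assume neg: "\<not> ?thesis"
  define T where "T = {(a, b). a \<in> D \<and> b \<in> D \<and> a \<le> 0 \<and> 0 \<le> b \<and> a < b}"
  define A where "A = (\<lambda>(a, b). chord_at_0 h a b) ` T"
  have 0: "0 \<notin> closed_segment w z" if "w \<in> A" "z \<in> A" for w z
    using neg that unfolding A_def T_def by auto
  \<comment> \<open>Since the total mass is 1, a property that holds almost surely has a
    witness.\<close>
  have ex: "AE x in M. P (S x) \<Longrightarrow> \<exists>s. P s" for P
    using AE_False by (metis (mono_tags, lifting) eventually_mono)
  have "convex T"
  proof -
    \<comment> \<open>The last factor is the open half-plane \<open>a < b\<close>.\<close>
    have "T = (D \<times> D) \<inter> {..0} \<times> {0..} \<inter> {z. (1, -1) \<bullet> z < 0}"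
      by (auto simp: T_def)
    then show ?thesis
      by (auto intro!: convex_Int convex_Times D convex_halfspace_lt)
  qed
  then have "connected T" by (rule convex_connected)
  moreover have "continuous_on T (\<lambda>(a, b). chord_at_0 h a b)"
    unfolding chord_at_0_def case_prod_unfold
    by (intro continuous_intros continuous_on_compose2[OF h]) (auto simp: T_def)
  ultimately have "connected A" unfolding A_def by (rule connected_continuous_image[rotated])
  \<comment> \<open>If \<open>S\<close> were 0 almost surely, then \<open>h 0 = 0\<close>, and the
    degenerate chord over \<open>(0, b0)\<close> equals \<open>h 0\<close>, so 0 itself would lie in
    \<open>A\<close>. The point \<open>b0\<close> is there because \<open>T\<close> demands
    \<open>a < b\<close>.\<close>
  have nz: "\<not> (AE x in M. S x = 0)"
  proof
    assume eq: "AE x in M. S x = 0"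
    then have "AE x in M. S x = 0 \<and> S x \<in> D" using S(3) by eventually_elim simp
    from ex[OF this] have "0 \<in> D" by auto
    then have "(0, b0) \<in> T" using D by (auto simp: T_def)
    then have "chord_at_0 h 0 b0 \<in> A" unfolding A_def by force
    moreover have "chord_at_0 h 0 b0 = h 0" using D by (simp add: chord_at_0_def)
    moreover have "AE x in M. h (S x) = h 0" using eq by eventually_elim simp
    then have "expectation (\<lambda>x. h (S x)) = expectation (\<lambda>x. h 0)"
      using hS by (intro integral_cong_AE) auto
    then have "h 0 = 0" using hS by (simp add: prob_space)
    ultimately show False using 0[of 0 0] by simp
  qed
  obtain p r where pr: "p \<in> D" "p < 0" "r \<in> D" "0 < r"
    using centred_support_both_signs[OF S nz] by blast
  then have "(p, r) \<in> T" by (auto simp: T_def)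
  then have "A \<noteq> {}" by (auto simp: A_def)
  from connected_lexicographic_half_plane[OF \<open>connected A\<close> this 0]
  obtain u v where uv: "\<And>w. w \<in> A \<Longrightarrow> 0 \<le> Re (u * w)"
    "\<And>w. w \<in> A \<Longrightarrow> Re (u * w) = 0 \<Longrightarrow> 0 < Re (v * w)" by blast
  define H K where "H = (\<lambda>s. Re (u * h s))" and "K = (\<lambda>s. Re (v * h s))"
  have chord: "Re (c * chord_at_0 h a b) = (b * Re (c * h a) - a * Re (c * h b)) / (b - a)"
    if "a < b" for a b c
  proof -
    have "Re (c * chord_at_0 h a b) = b / (b - a) * Re (c * h a) + - a / (b - a) * Re (c * h b)"
      unfolding chord_at_0_def ring_distribs mult_scaleR_right plus_complex.sel scaleR_complex.sel ..
    then show ?thesis by (simp add: diff_divide_distrib)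
  qed
  \<comment> \<open>Cleared of the denominator \<open>b - a\<close>, lexicographic positivity on
    \<open>A\<close> takes the form that \<open>slope_through_origin\<close> expects.\<close>
  have HT: "0 \<le> b * H a - a * H b" "b * H a - a * H b = 0 \<Longrightarrow> 0 < b * K a - a * K b"
    if "a \<in> D" "b \<in> D" "a \<le> 0" "0 \<le> b" "a < b" for a b
  proof -
    have "chord_at_0 h a b \<in> A" using that by (force simp: A_def T_def)
    from uv[OF this] show "0 \<le> b * H a - a * H b" "b * H a - a * H b = 0 \<Longrightarrow> 0 < b * K a - a * K b"
      using that unfolding chord[OF \<open>a < b\<close>] H_def K_def by (auto simp: zero_le_divide_iff zero_less_divide_iff)
  qed
  have int: "integrable M (\<lambda>x. Re (c * h (S x)))" "expectation (\<lambda>x. Re (c * h (S x))) = 0" for c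
    using hS by auto
  \<comment> \<open>the supporting line touches \<open>H\<close> almost everywhere, which leaves \<open>K\<close> to decide\<close>
  have intH: "integrable M (\<lambda>x. H (S x))" "expectation (\<lambda>x. H (S x)) = 0"
    and intK: "integrable M (\<lambda>x. K (S x))" "expectation (\<lambda>x. K (S x)) = 0"
    unfolding H_def K_def by (rule int)+
  obtain c where c: "\<And>s. s \<in> D \<Longrightarrow> c * s \<le> H s"
    using slope_through_origin[OF pr, of H] HT by blast
  have "AE x in M. H (S x) = c * S x"
    using S intH c by (intro AE_eq_if_integral_eq) auto
  then have AE1: "AE x in M. S x \<in> {s \<in> D. H s = c * s}" using S(3) by eventually_elim auto
  obtain p1 r1 where pr1: "p1 \<in> {s \<in> D. H s = c * s}" "p1 < 0" "r1 \<in> {s \<in> D. H s = c * s}" "0 < r1"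
    using centred_support_both_signs[OF S(1,2) AE1 nz] by blast
  \<comment> \<open>Between points with \<open>H s = c * s\<close> the expression
    \<open>b * H a - a * H b\<close> is 0, so the second part of \<open>HT\<close> applies and
    \<open>K\<close> gets a supporting line on the contact set.\<close>
  obtain d where d: "\<And>s. s \<in> {s \<in> D. H s = c * s} \<Longrightarrow> d * s \<le> K s"
    using slope_through_origin[OF pr1, of K] HT by (force simp: less_imp_le)
  have "AE x in M. d * S x \<le> K (S x)" using AE1 by eventually_elim (rule d)
  then have "AE x in M. K (S x) = d * S x"
    using S intK by (intro AE_eq_if_integral_eq) auto
  then have AE2: "AE x in M. S x \<in> {s \<in> D. H s = c * s \<and> K s = d * s}"
    using AE1 by eventually_elim auto
  \<comment> \<open>At these two points both \<open>H\<close> and \<open>K\<close> lie on lines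
    through the origin, so both chords vanish at 0, which the strict inequality forbids.\<close>
  obtain p2 r2 where pr2: "p2 \<in> {s \<in> D. H s = c * s \<and> K s = d * s}" "p2 < 0"
      "r2 \<in> {s \<in> D. H s = c * s \<and> K s = d * s}" "0 < r2"
    using centred_support_both_signs[OF S(1,2) AE2 nz] by blast
  then show False using HT(2)[of p2 r2] by simp
qed

section \<open>The perspective function, its boundary limits and its continuity\<close>

text \<open>The 1-homogeneous integrand of \<open>D_f\<close>. Where a limit at the boundary is infinite it takes the
  junk value 0; these points are excluded by \<open>persp_finite\<close>.\<close>
definition persp :: "(real \<Rightarrow> real) \<Rightarrow> real \<Rightarrow> real \<Rightarrow> real" where
  "persp f p q = (if q = 0 then p * real_of_ereal (fstar0 f)
     else if p = 0 then q * real_of_ereal (fzero f) else q * f (p / q))"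

text \<open>The pair \<open>p = q = 0\<close> imposes nothing, so points of zero mass are
  harmless.\<close>

definition persp_finite :: "(real \<Rightarrow> real) \<Rightarrow> real \<Rightarrow> real \<Rightarrow> bool" where
  "persp_finite f p q \<longleftrightarrow> (p = 0 \<and> q \<noteq> 0 \<longrightarrow> \<bar>fzero f\<bar> \<noteq> \<infinity>) \<and> (q = 0 \<and> p \<noteq> 0 \<longrightarrow> \<bar>fstar0 f\<bar> \<noteq> \<infinity>)"

lemma persp_scale: "persp f (c * p) (c * q) = c * persp f p q"
  by (simp add: persp_def)

lemma persp_finite_scale: "c \<noteq> 0 \<Longrightarrow> persp_finite f (c * p) (c * q) \<longleftrightarrow> persp_finite f p q"
  by (simp add: persp_finite_def)

text \<open>The use is with \<open>c = 1\<close>, where \<open>f\<close> vanishes: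
  \<open>f t / (t - 1)\<close> is monotone on either side of 1.\<close>

lemma convex_slope_mono:
  fixes f :: "real \<Rightarrow> real"
  assumes f: "convex_on I f" and I: "a \<in> I" "b \<in> I" "c \<in> I" and "a \<le> b" "a \<noteq> c" "b \<noteq> c"
  shows "(f a - f c) / (a - c) \<le> (f b - f c) / (b - c)"
proof -
  have swap: "(u - v) / (w - z) = (v - u) / (z - w)" for u v w z :: real
    by (metis minus_diff_eq minus_divide_divide)
  consider "a = b" | "a < b" "b < c" | "a < c" "c < b" | "c < a" "a < b"
    using assms by linarith
  then show ?thesis
  proof cases
    case 2
    then show ?thesis using convex_on_slope_le(2)[OF f I(1,3) 2] by simp
  next
    case 3
    then show ?thesis using convex_on_slope_le[OF f I(1,2) 3] swap[of "f c" "f b" c b] by linarith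
  next
    case 4
    then show ?thesis
      using convex_on_slope_le(1)[OF f I(3,2) 4] swap[of "f c" "f b" c b] swap[of "f c" "f a" c a] by linarith
  qed simp
qed

text \<open>\<open>Lim\<close> is informative only once a limit exists. The secant slope
  \<open>f t / (t - 1)\<close> is monotone on (0, 1), so it tends to its infimum in the extended
  reals, and \<open>f t\<close> is \<open>t - 1\<close> times that slope.\<close>

lemma fzero_tendsto:
  assumes f: "convex_on {0<..} f" "f 1 = 0"
  shows "((\<lambda>t. ereal (f t)) \<longlongrightarrow> fzero f) (at_right 0)"
proof -
  let ?m = "\<lambda>t. ereal (f t / (t - 1))"
  let ?L = "Inf (?m ` ({0<..} \<inter> {..<1}))"
  have mono: "?m a \<le> ?m b" if "0 < a" "a \<le> b" "b < 1" for a b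
    using convex_slope_mono[OF f(1), of a b 1] that f(2) by auto
  have "(?m \<longlongrightarrow> ?L) (at 0 within ({0<..} \<inter> {..<1}))"
    by (rule Lim_right_bound[where K="-\<infinity>"]) (use mono in auto)
  moreover have "at 0 within ({0<..} \<inter> {..<1}) = at_right (0::real)"
    by (rule at_within_nhd[of _ "{..<1}"]) auto
  ultimately have lim: "(?m \<longlongrightarrow> ?L) (at_right 0)" by simp
  have t: "((\<lambda>t. ereal (t - 1)) \<longlongrightarrow> ereal (0 - 1)) (at_right 0)"
    by (intro tendsto_intros)
  \<comment> \<open>The first factor tends to -1 and not to 0, so the product rule also covers an
    infinite \<open>?L\<close>.\<close>
  have "((\<lambda>t. ereal (t - 1) * ?m t) \<longlongrightarrow> ereal (0 - 1) * ?L) (at_right 0)"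
    by (rule tendsto_mult_ereal[OF t lim]) auto
  moreover have "eventually (\<lambda>t. ereal (t - 1) * ?m t = ereal (f t)) (at_right (0::real))"
    by (auto simp: eventually_at_right[of 0 1] intro!: exI[of _ 1])
  ultimately have *: "((\<lambda>t. ereal (f t)) \<longlongrightarrow> ereal (0 - 1) * ?L) (at_right 0)"
    by (rule Lim_transform_eventually)
  then have "fzero f = ereal (0 - 1) * ?L"
    unfolding fzero_def by (intro tendsto_Lim) auto
  with * show ?thesis by simp
qed

text \<open>The substitution of \<open>inverse t\<close> moves infinity to 0. It reverses
  monotonicity, which the minus sign in \<open>?n\<close> restores, and
  \<open>(t - 1) * ?n t\<close> becomes \<open>f (inverse t) / inverse t\<close>.\<close>

lemma fstar0_tendsto:
  assumes f: "convex_on {0<..} f" "f 1 = 0"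
  shows "((\<lambda>t. ereal (f t / t)) \<longlongrightarrow> fstar0 f) at_top"
proof -
  let ?m = "\<lambda>t. ereal (f t / (t - 1))"
  let ?n = "\<lambda>t. - ?m (inverse t)"
  let ?L = "Inf (?n ` ({0<..} \<inter> {..<1}))"
  have mono: "?n a \<le> ?n b" if "0 < a" "a \<le> b" "b < 1" for a b
  proof -
    have "inverse b \<le> inverse a" "inverse b > 1" "inverse a > 1"
      using that by (auto simp: field_simps)
    then show ?thesis
      using convex_slope_mono[OF f(1), of "inverse b" "inverse a" 1] that f(2) by auto
  qed
  have "(?n \<longlongrightarrow> ?L) (at 0 within ({0<..} \<inter> {..<1}))"
    by (rule Lim_right_bound[where K="-\<infinity>"]) (use mono in auto)
  moreover have "at 0 within ({0<..} \<inter> {..<1}) = at_right (0::real)"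
    by (rule at_within_nhd[of _ "{..<1}"]) auto
  ultimately have lim: "(?n \<longlongrightarrow> ?L) (at_right 0)" by simp
  have t: "((\<lambda>t. ereal (t - 1)) \<longlongrightarrow> ereal (0 - 1)) (at_right 0)"
    by (intro tendsto_intros)
  have "((\<lambda>t. ereal (t - 1) * ?n t) \<longlongrightarrow> ereal (0 - 1) * ?L) (at_right 0)"
    by (rule tendsto_mult_ereal[OF t lim]) auto
  moreover have "eventually (\<lambda>t. ereal (t - 1) * ?n t = ereal (f (inverse t) / inverse t)) (at_right (0::real))"
    unfolding eventually_at_right[OF zero_less_one]
    by (intro exI[of _ 1]) (auto simp: field_simps)
  ultimately have "((\<lambda>t. ereal (f (inverse t) / inverse t)) \<longlongrightarrow> ereal (0 - 1) * ?L) (at_right 0)"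
    by (rule Lim_transform_eventually)
  then have *: "((\<lambda>t. ereal (f t / t)) \<longlongrightarrow> ereal (0 - 1) * ?L) at_top"
    by (simp add: filterlim_at_top_to_right)
  then have "fstar0 f = ereal (0 - 1) * ?L"
    unfolding fstar0_def by (intro tendsto_Lim) auto
  with * show ?thesis by simp
qed

text \<open>At \<open>s = 1\<close> the ratio \<open>(1 - s) / (1 + s)\<close> tends to 0 from the
  right and at \<open>s = -1\<close> to infinity, so the limits \<open>fzero\<close> and
  \<open>fstar0\<close> give continuity at whichever endpoints belong to the domain.\<close>

lemma persp_continuous:
  assumes f: "convex_on {0<..} f" "f 1 = 0"
  shows "continuous_on {s \<in> {-1..1}. persp_finite f (1 - s) (1 + s)} (\<lambda>s. persp f (1 - s) (1 + s))"
    (is "continuous_on ?D ?F")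
proof (rule continuous_on_eq_continuous_within[THEN iffD2], rule ballI)
  fix s assume s: "s \<in> ?D"
  have cont: "continuous_on {0<..} f" by (rule convex_on_continuous[OF _ f(1)]) simp
  have int: "isCont ?F s" if "-1 < s" "s < 1" for s
  proof -
    have "continuous_on {-1<..<1} (\<lambda>s. (1 + s) * f ((1 - s) / (1 + s)))"
      by (intro continuous_intros continuous_on_compose2[OF cont]) auto
    then have "continuous_on {-1<..<1} ?F"
      by (rule continuous_on_eq) (auto simp: persp_def)
    then show ?thesis using that continuous_on_eq_continuous_at[of "{-1<..<1}" ?F] by auto
  qed
  consider "-1 < s" "s < 1" | "s = 1" | "s = -1" using s by fastforce
  then show "continuous (at s within ?D) ?F"
  proof cases
    case 1
    then show ?thesis using int continuous_at_imp_continuous_at_within by blast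
  next
    case 2
    then have fin: "\<bar>fzero f\<bar> \<noteq> \<infinity>" using s by (auto simp: persp_finite_def)
    then have "((\<lambda>t. ereal (f t)) \<longlongrightarrow> ereal (real_of_ereal (fzero f))) (at_right 0)"
      using fzero_tendsto[OF f] by (simp add: ereal_real)
    then have f0: "(f \<longlongrightarrow> real_of_ereal (fzero f)) (at_right 0)" by simp
    have lim: "filterlim (\<lambda>s. (1 - s) / (1 + s)) (at_right 0) (at_left (1::real))"
      unfolding filterlim_at
    proof
      show "\<forall>\<^sub>F x in at_left 1. (1 - x) / (1 + x) \<in> {0<..} \<and> (1 - x) / (1 + x) \<noteq> (0::real)"
        unfolding eventually_at_left[OF zero_less_one] by (intro exI[of _ 0]) auto
    qed (auto intro!: tendsto_eq_intros)
    have "((\<lambda>s. (1 + s) * f ((1 - s) / (1 + s))) \<longlongrightarrow> (1 + 1) * real_of_ereal (fzero f)) (at_left 1)"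
      by (intro tendsto_intros filterlim_compose[OF f0 lim])
    moreover have "eventually (\<lambda>s. (1 + s) * f ((1 - s) / (1 + s)) = ?F s) (at_left 1)"
      unfolding eventually_at_left[OF zero_less_one] by (intro exI[of _ 0]) (auto simp: persp_def)
    ultimately have "(?F \<longlongrightarrow> (1 + 1) * real_of_ereal (fzero f)) (at_left 1)"
      by (rule Lim_transform_eventually)
    then have "(?F \<longlongrightarrow> ?F 1) (at 1 within {..<1})" by (simp add: persp_def)
    \<comment> \<open>The filter ignores the point 1 itself, so the endpoint may be added.\<close>
    then have "(?F \<longlongrightarrow> ?F 1) (at 1 within {..1})"
      by (metis at_within_Icc_at_left at_within_Iic_at_left)
    then show ?thesis unfolding continuous_within 2
      by (rule tendsto_within_subset) auto
  next
    case 3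
    then have fin: "\<bar>fstar0 f\<bar> \<noteq> \<infinity>" using s by (auto simp: persp_finite_def)
    then have "((\<lambda>t. ereal (f t / t)) \<longlongrightarrow> ereal (real_of_ereal (fstar0 f))) at_top"
      using fstar0_tendsto[OF f] by (simp add: ereal_real)
    then have f0: "((\<lambda>t. f t / t) \<longlongrightarrow> real_of_ereal (fstar0 f)) at_top" by simp
    have "filterlim (\<lambda>s. 1 + s) (at_right 0) (at_right (-1::real))"
      unfolding filterlim_at
    proof
      show "\<forall>\<^sub>F x in at_right (-1). (1 + x) \<in> {0<..} \<and> (1 + x) \<noteq> (0::real)"
        by (auto simp: eventually_at_right[of "-1::real" 0] intro!: exI[of _ 0])
    qed (auto intro!: tendsto_eq_intros)
    then have lim: "filterlim (\<lambda>s. (1 - s) / (1 + s)) at_top (at_right (-1::real))"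
      unfolding divide_inverse
      by (intro filterlim_tendsto_pos_mult_at_top[of _ "1 - (-1)"] tendsto_intros
         filterlim_compose[OF filterlim_inverse_at_top_right]) auto
    \<comment> \<open>With \<open>r = (1 - s) / (1 + s)\<close>, the product
      \<open>(1 + s) * f r\<close> is rewritten as \<open>(1 - s) * (f r / r)\<close> to bring in
      the limit of \<open>f r / r\<close>.\<close>
    have "((\<lambda>s. (1 - s) * (f ((1 - s) / (1 + s)) / ((1 - s) / (1 + s)))) \<longlongrightarrow> (1 - (-1)) * real_of_ereal (fstar0 f)) (at_right (-1))"
      by (intro tendsto_intros filterlim_compose[OF f0 lim])
    moreover have "eventually (\<lambda>s. (1 - s) * (f ((1 - s) / (1 + s)) / ((1 - s) / (1 + s))) = ?F s) (at_right (-1))"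
      by (auto simp: eventually_at_right[of "-1::real" 0] persp_def intro!: exI[of _ 0])
    ultimately have "(?F \<longlongrightarrow> (1 - (-1)) * real_of_ereal (fstar0 f)) (at_right (-1))"
      by (rule Lim_transform_eventually)
    then have "(?F \<longlongrightarrow> ?F (-1)) (at (-1) within {-1<..})" by (simp add: persp_def)
    then have "(?F \<longlongrightarrow> ?F (-1)) (at (-1) within {-1..})"
      by (metis at_within_Icc_at_right at_within_Ici_at_right)
    then show ?thesis unfolding continuous_within 3
      by (rule tendsto_within_subset) auto
  qed
qed

section \<open>Divergences as Bochner integrals of the perspective\<close>

lemma eint_eq_integral:
  assumes "AE x in M. h x = ereal (r x)" "integrable M r"
  shows "eint M h = ereal (integral\<^sup>L M r)"
proof -
  have "(\<integral>\<^sup>+ x. e2ennreal (h x) \<partial>M) = (\<integral>\<^sup>+ x. ennreal (r x) \<partial>M)"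
    "(\<integral>\<^sup>+ x. e2ennreal (- h x) \<partial>M) = (\<integral>\<^sup>+ x. ennreal (- r x) \<partial>M)"
    using assms(1) by (auto intro!: nn_integral_cong_AE elim!: eventually_mono simp: ennreal_def)
  moreover obtain a b where "(\<integral>\<^sup>+ x. ennreal (r x) \<partial>M) = ennreal a" "0 \<le> a"
    "(\<integral>\<^sup>+ x. ennreal (- r x) \<partial>M) = ennreal b" "0 \<le> b"
    using assms(2) unfolding real_integrable_def
    by (metis ennreal_cases infinity_ennreal_def)
  ultimately show ?thesis unfolding eint_def
    by (simp add: real_lebesgue_integral_def[OF assms(2)])
qed

lemma eint_real_imp:
  assumes h[measurable]: "h \<in> borel_measurable M" and eq: "eint M h = ereal x"
  shows "AE x in M. \<bar>h x\<bar> \<noteq> \<infinity>" "integrable M (\<lambda>x. real_of_ereal (h x))"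
    "(\<integral>x. real_of_ereal (h x) \<partial>M) = x"
proof -
  let ?P = "\<integral>\<^sup>+ x. e2ennreal (h x) \<partial>M" and ?N = "\<integral>\<^sup>+ x. e2ennreal (- h x) \<partial>M"
  have fin: "?P \<noteq> \<infinity>" "?N \<noteq> \<infinity>"
    \<comment> \<open>in \<open>ereal\<close>, \<open>\<infinity> - \<infinity> = \<infinity>\<close>, so a finite difference has finite terms\<close>
    using eq unfolding eint_def by (cases "enn2ereal ?P"; auto simp: top_ennreal.rep_eq)+
  have "AE x in M. e2ennreal (h x) \<noteq> \<infinity>" "AE x in M. e2ennreal (- h x) \<noteq> \<infinity>"
    by (rule nn_integral_PInf_AE[OF _ fin(1)] nn_integral_PInf_AE[OF _ fin(2)], measurable)+
  then show AE: "AE x in M. \<bar>h x\<bar> \<noteq> \<infinity>"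
    by eventually_elim auto
  have "?P = (\<integral>\<^sup>+ x. ennreal (real_of_ereal (h x)) \<partial>M)"
    "?N = (\<integral>\<^sup>+ x. ennreal (- real_of_ereal (h x)) \<partial>M)"
    using AE by (auto intro!: nn_integral_cong_AE elim!: eventually_mono simp: ennreal_def ereal_real)
  then show int: "integrable M (\<lambda>x. real_of_ereal (h x))"
    using fin unfolding real_integrable_def by auto
  have "AE x in M. h x = ereal (real_of_ereal (h x))"
    using AE by eventually_elim (simp add: ereal_real)
  from eint_eq_integral[OF this int] eq
  show "(\<integral>x. real_of_ereal (h x) \<partial>M) = x" by simp
qed

lemma fext_measurable:
  assumes "convex_on {0<..} f"
  shows "fext f \<in> borel_measurable borel"
proof -
  have "continuous_on {0<..} f" by (rule convex_on_continuous[OF _ assms]) simp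
  \<comment> \<open>Nothing is known of \<open>f\<close> off the positive reals; the indicator
    removes those values.\<close>
  then have [measurable]: "(\<lambda>t. indicator {0<..} t *\<^sub>R f t) \<in> borel_measurable borel"
    by (rule borel_measurable_continuous_on_indicator[rotated]) simp
  have "fext f = (\<lambda>t. if t > 0 then ereal (indicator {0<..} t *\<^sub>R f t) else fzero f)"
    by (auto simp: fext_def)
  also have "\<dots> \<in> borel_measurable borel" by measurable
  finally show ?thesis .
qed

context
  fixes f :: "real \<Rightarrow> real" and M :: "'a measure" and p q :: "'a \<Rightarrow> real"
  assumes f: "convex_on {0<..} f"
    and p[measurable]: "p \<in> borel_measurable M" and q[measurable]: "q \<in> borel_measurable M"
    and p_nonneg: "\<And>x. x \<in> space M \<Longrightarrow> 0 \<le> p x" and q_nonneg: "\<And>x. x \<in> space M \<Longrightarrow> 0 \<le> q x"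
    and p_int: "integrable M p"
begin

private definition "h x = (if q x > 0 then fext f (p x / q x) else 0)"
private definition "Z = {x \<in> space M. q x = 0}"

private lemma h_measurable[measurable]: "h \<in> borel_measurable M"
proof -
  have [measurable]: "fext f \<in> borel_measurable borel" by (rule fext_measurable[OF f])
  show ?thesis unfolding h_def by measurable
qed

private lemma Z_sets[measurable]: "Z \<in> sets M"
  unfolding Z_def by measurable

private lemma AE_nonneg: "AE x in M. 0 \<le> p x" "AE x in M. 0 \<le> q x"
  using p_nonneg q_nonneg by auto

private lemma Z_measure:
  "measure (density M p) Z = (\<integral>x. p x * indicator Z x \<partial>M)" "integrable M (\<lambda>x. p x * indicator Z x)"
proof -
  have "measure (density M p) Z = (\<integral>x. indicator Z x \<partial>density M p)"
    using sets.Int_space_eq2[OF Z_sets] by simp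
  also have "\<dots> = (\<integral>x. p x * indicator Z x \<partial>M)"
    by (rule integral_real_density) (use AE_nonneg in auto)
  finally show "measure (density M p) Z = (\<integral>x. p x * indicator Z x \<partial>M)" .
  show "integrable M (\<lambda>x. p x * indicator Z x)"
    using integrable_real_mult_indicator[OF Z_sets p_int] by (simp add: mult.commute)
qed

private lemma fdiv_h: "fdiv f M p q = eint (density M q) h + fstar0 f * ereal (measure (density M p) Z)"
  by (simp add: fdiv_def h_def[abs_def] Z_def)

text \<open>This matches the two summands of the divergence pointwise. It holds even where a limit
  is infinite, since both sides then contain the same junk value 0.\<close>

private lemma persp_h:
  assumes "x \<in> space M"
  shows "persp f (p x) (q x) = q x * real_of_ereal (h x) + real_of_ereal (fstar0 f) * (p x * indicator Z x)"
  using assms p_nonneg[OF assms] q_nonneg[OF assms]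
  by (auto simp: persp_def h_def Z_def fext_def)

lemma fdiv_real_imp_integral:
  assumes eq: "fdiv f M p q = ereal y"
  shows "AE x in M. persp_finite f (p x) (q x)" "integrable M (\<lambda>x. persp f (p x) (q x))"
    "(\<integral>x. persp f (p x) (q x) \<partial>M) = y"
proof -
  let ?c = "fstar0 f * ereal (measure (density M p) Z)"
  \<comment> \<open>A real sum of extended reals has real summands, because
    \<open>\<infinity> + (-\<infinity>)\<close> is \<open>\<infinity>\<close>.\<close>
  have "\<bar>eint (density M q) h\<bar> \<noteq> \<infinity>" and c: "\<bar>?c\<bar> \<noteq> \<infinity>"
    using eq unfolding fdiv_h by (cases "eint (density M q) h"; cases ?c; simp)+
  then obtain z where z: "eint (density M q) h = ereal z" by auto
  note E = eint_real_imp[OF _ z, simplified measurable_density_eq1, OF h_measurable]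
  have hf: "AE x in M. 0 < q x \<longrightarrow> \<bar>h x\<bar> \<noteq> \<infinity>"
    using E(1) by (simp add: AE_density)
  \<comment> \<open>A finite product \<open>?c\<close> leaves two options: a finite
    \<open>fstar0 f\<close>, or no mass of \<open>P\<close> on \<open>Z\<close>.\<close>
  have star: "\<bar>fstar0 f\<bar> \<noteq> \<infinity> \<or> (AE x in M. p x * indicator Z x = 0)"
  proof (cases "measure (density M p) Z = 0")
    case True
    have "AE x in M. 0 \<le> p x * indicator Z x" using AE_nonneg(1) by eventually_elim simp
    then show ?thesis
      using integral_nonneg_eq_0_iff_AE[OF Z_measure(2)] True unfolding Z_measure(1) by blast
  next
    case False
    then have "measure (density M p) Z > 0" by (simp add: zero_less_measure_iff)
    then show ?thesis using c by (cases "fstar0 f") auto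
  qed
  then have "AE x in M. p x \<noteq> 0 \<and> x \<in> Z \<longrightarrow> \<bar>fstar0 f\<bar> \<noteq> \<infinity>"
  proof
    assume "AE x in M. p x * indicator Z x = 0"
    then show ?thesis by eventually_elim auto
  qed simp
  then show "AE x in M. persp_finite f (p x) (q x)"
    using hf AE_space
  proof eventually_elim
    case (elim x)
    then show ?case using q_nonneg[of x] by (auto simp: persp_finite_def h_def fext_def Z_def)
  qed
  have int: "integrable M (\<lambda>x. q x * real_of_ereal (h x))"
    using E(2) AE_nonneg(2) by (subst integrable_real_density[symmetric]) auto
  have "(\<integral>x. q x * real_of_ereal (h x) \<partial>M) = z"
    using E(3) AE_nonneg(2) by (subst integral_real_density[symmetric]) auto
  then have val: "(\<integral>x. q x * real_of_ereal (h x) + real_of_ereal (fstar0 f) * (p x * indicator Z x) \<partial>M)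
      = z + real_of_ereal (fstar0 f) * measure (density M p) Z"
    using int Z_measure by simp
  show "integrable M (\<lambda>x. persp f (p x) (q x))"
    using int Z_measure by (subst Bochner_Integration.integrable_cong[OF refl persp_h]) auto
  \<comment> \<open>For infinite \<open>fstar0 f\<close> the mass of \<open>Z\<close> is 0, and
    \<open>\<infinity> * 0 = 0\<close> agrees with the junk value.\<close>
  have "?c = ereal (real_of_ereal (fstar0 f) * measure (density M p) Z)"
  proof (cases "\<bar>fstar0 f\<bar> = \<infinity>")
    case True
    then show ?thesis using c by (cases "fstar0 f"; cases "measure (density M p) Z = 0"; auto split: if_splits)
  next
    case False
    then show ?thesis by (cases "fstar0 f") auto
  qed
  then show "(\<integral>x. persp f (p x) (q x) \<partial>M) = y"
    using eq val z unfolding fdiv_h by (subst Bochner_Integration.integral_cong[OF refl persp_h]) auto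
qed

text \<open>The converse passage, which evaluates the divergences of finite pairs. If
  \<open>fstar0 f\<close> is infinite, \<open>fin\<close> forces \<open>p = 0\<close> almost
  everywhere on \<open>Z\<close>, so the boundary term is 0.\<close>

lemma fdiv_eq_integral:
  assumes fin: "AE x in M. persp_finite f (p x) (q x)" and int: "integrable M (\<lambda>x. persp f (p x) (q x))"
  shows "fdiv f M p q = ereal (\<integral>x. persp f (p x) (q x) \<partial>M)"
proof -
  have 1: "integrable M (\<lambda>x. q x * real_of_ereal (h x))"
  proof -
    have "q x * real_of_ereal (h x) = persp f (p x) (q x) - real_of_ereal (fstar0 f) * (p x * indicator Z x)"
      if "x \<in> space M" for x
      using persp_h[OF that] by simp
    note Bochner_Integration.integrable_cong[OF refl this]
    moreover have "integrable M (\<lambda>x. persp f (p x) (q x) - real_of_ereal (fstar0 f) * (p x * indicator Z x))"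
      using int Z_measure by (intro Bochner_Integration.integrable_diff integrable_mult_right)
    ultimately show ?thesis by (rule iffD2)
  qed
  then have 2: "integrable (density M q) (\<lambda>x. real_of_ereal (h x))"
    using AE_nonneg(2) by (subst integrable_real_density) auto
  have "AE x in M. 0 < ennreal (q x) \<longrightarrow> h x = ereal (real_of_ereal (h x))"
    using fin AE_nonneg
    by eventually_elim (auto simp: persp_finite_def h_def fext_def ereal_real zero_less_divide_iff)
  then have "AE x in density M q. h x = ereal (real_of_ereal (h x))"
    by (subst AE_density) auto
  from eint_eq_integral[OF this 2] have "eint (density M q) h = ereal (\<integral>x. q x * real_of_ereal (h x) \<partial>M)"
    using AE_nonneg(2) by (subst (asm) integral_real_density) auto
  moreover have "fstar0 f * ereal (measure (density M p) Z) = ereal (real_of_ereal (fstar0 f) * measure (density M p) Z)"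
  proof (cases "\<bar>fstar0 f\<bar> = \<infinity>")
    case True
    then have "AE x in M. p x * indicator Z x = 0"
      using fin by (auto elim!: eventually_mono simp: persp_finite_def Z_def indicator_def)
    then have "measure (density M p) Z = 0"
      unfolding Z_measure by (simp add: integral_eq_zero_AE)
    then show ?thesis by (simp add: zero_ereal_def[symmetric])
  next
    case False
    then show ?thesis by (cases "fstar0 f") auto
  qed
  moreover have "(\<integral>x. persp f (p x) (q x) \<partial>M)
      = (\<integral>x. q x * real_of_ereal (h x) \<partial>M) + real_of_ereal (fstar0 f) * measure (density M p) Z"
    using 1 Z_measure by (subst Bochner_Integration.integral_cong[OF refl persp_h]) auto
  ultimately show ?thesis unfolding fdiv_h by simp
qed

end

section \<open>Finite pairs, and measurability of the perspective\<close>

lemma fdiv_count_space: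
  fixes w s :: "nat \<Rightarrow> real"
  assumes f: "convex_on {0<..} f"
    and w: "\<And>i. i < d \<Longrightarrow> 0 \<le> w i" and s: "\<And>i. i < d \<Longrightarrow> s i \<in> {-1..1}"
    and fin: "\<And>i. i < d \<Longrightarrow> persp_finite f (1 - s i) (1 + s i)"
  shows "fdiv f (count_space {..<d}) (\<lambda>i. w i * (1 - s i)) (\<lambda>i. w i * (1 + s i))
    = ereal (\<Sum>i<d. w i * persp f (1 - s i) (1 + s i))"
proof -
  have "persp_finite f (w i * (1 - s i)) (w i * (1 + s i))" if "i < d" for i
    using fin[OF that] by (cases "w i = 0") (auto simp: persp_finite_scale, simp add: persp_finite_def)
  moreover have "0 \<le> w i * (1 - s i)" "0 \<le> w i * (1 + s i)" if "i < d" for i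
    using w[OF that] s[OF that] by simp_all
  ultimately show ?thesis
    by (subst fdiv_eq_integral[OF f])
       (simp_all add: AE_count_space integrable_count_space lebesgue_integral_count_space_finite persp_scale)
qed

lemma persp_measurable:
  assumes "convex_on {0<..} f"
    and [measurable]: "p \<in> borel_measurable M" "q \<in> borel_measurable M"
    and nonneg: "\<And>x. x \<in> space M \<Longrightarrow> 0 \<le> p x" "\<And>x. x \<in> space M \<Longrightarrow> 0 \<le> q x"
  shows "(\<lambda>x. persp f (p x) (q x)) \<in> borel_measurable M"
proof -
  have [measurable]: "fext f \<in> borel_measurable borel" by (rule fext_measurable) fact
  have "(\<lambda>x. if q x = 0 then p x * real_of_ereal (fstar0 f) else q x * real_of_ereal (fext f (p x / q x)))
      \<in> borel_measurable M"
    by measurable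
  moreover have "persp f (p x) (q x) =
      (if q x = 0 then p x * real_of_ereal (fstar0 f) else q x * real_of_ereal (fext f (p x / q x)))"
    if "x \<in> space M" for x
    using nonneg[OF that] by (auto simp: persp_def fext_def zero_less_divide_iff)
  ultimately show ?thesis by (simp cong: measurable_cong)
qed

text \<open>The law with masses \<open>w i\<close> at \<open>s i\<close> encodes the pair with
  entries \<open>w i * (1 - s i)\<close> and \<open>w i * (1 + s i)\<close>; total mass 1 and mean 0
  make both vectors sum to 1.\<close>

lemma d_achievable_weights:
  fixes w s :: "nat \<Rightarrow> real"
  assumes f: "convex_on {0<..} f" and g: "convex_on {0<..} g"
    and w: "\<And>i. i < d \<Longrightarrow> 0 \<le> w i" and s: "\<And>i. i < d \<Longrightarrow> s i \<in> {-1..1}"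
    and fin: "\<And>i. i < d \<Longrightarrow> persp_finite f (1 - s i) (1 + s i)" "\<And>i. i < d \<Longrightarrow> persp_finite g (1 - s i) (1 + s i)"
    and sum: "(\<Sum>i<d. w i) = 1" "(\<Sum>i<d. w i * s i) = 0"
  shows "d_achievable d f g (\<Sum>i<d. w i * persp f (1 - s i) (1 + s i)) (\<Sum>i<d. w i * persp g (1 - s i) (1 + s i))"
  unfolding d_achievable_def
proof (intro exI conjI allI impI)
  show "0 \<le> w i * (1 - s i)" "0 \<le> w i * (1 + s i)" if "i < d" for i
    using w[OF that] s[OF that] by simp_all
  show "(\<Sum>i<d. w i * (1 - s i)) = 1" "(\<Sum>i<d. w i * (1 + s i)) = 1"
    using sum by (auto simp: algebra_simps sum_subtractf sum.distrib)
qed (rule fdiv_count_space; use f g w s fin in simp)+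

section \<open>From an arbitrary pair to two and to four points\<close>

theorem theorem2:
  fixes f g :: "real \<Rightarrow> real" and x y :: real
  assumes "convex_on {0<..} f" and "convex_on {0<..} g"
    and "f 1 = 0" and "g 1 = 0"
    and "fg_achievable TYPE('a) f g x y"
  shows "(\<exists>x1 y1 x2 y2 (t::real). 0 \<le> t \<and> t \<le> 1 \<and>
            d_achievable 2 f g x1 y1 \<and> d_achievable 2 f g x2 y2 \<and>
            x = t * x1 + (1 - t) * x2 \<and> y = t * y1 + (1 - t) * y2)
         \<and> d_achievable 4 f g x y"
proof -
  note f = assms(1,3) and g = assms(2,4)
  obtain M :: "'a measure" and p q where dens: "is_density M p" "is_density M q"
    and fd: "fdiv f M p q = ereal x" and gd: "fdiv g M p q = ereal y"
    using assms(5) unfolding fg_achievable_def by blast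
  have meas[measurable]: "p \<in> borel_measurable M" "q \<in> borel_measurable M"
    and nonneg: "\<And>x. x \<in> space M \<Longrightarrow> 0 \<le> p x" "\<And>x. x \<in> space M \<Longrightarrow> 0 \<le> q x"
    and mass: "(\<integral>\<^sup>+ x. ennreal (p x) \<partial>M) = ennreal 1" "(\<integral>\<^sup>+ x. ennreal (q x) \<partial>M) = ennreal 1"
    using dens by (auto simp: is_density_def)
  have "has_bochner_integral M p 1" "has_bochner_integral M q 1"
    using mass nonneg by (auto intro!: has_bochner_integral_nn_integral)
  then have int: "integrable M p" "integral\<^sup>L M p = 1" "integrable M q" "integral\<^sup>L M q = 1"
    by (auto simp: has_bochner_integral_iff)
  have F: "AE x in M. persp_finite f (p x) (q x)" "integrable M (\<lambda>x. persp f (p x) (q x))"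
      "(\<integral>x. persp f (p x) (q x) \<partial>M) = x"
    by (rule fdiv_real_imp_integral[OF f(1) meas _ _ int(1) fd]; fact nonneg)+
  have G: "AE x in M. persp_finite g (p x) (q x)" "integrable M (\<lambda>x. persp g (p x) (q x))"
      "(\<integral>x. persp g (p x) (q x) \<partial>M) = y"
    by (rule fdiv_real_imp_integral[OF g(1) meas _ _ int(1) gd]; fact nonneg)+
  \<comment> \<open>\<open>w\<close> is the density of \<open>(P + Q) / 2\<close>. Where
    \<open>p + q = 0\<close>, division by zero sets \<open>S\<close> to 0, and \<open>w = 0\<close>
    there.\<close>
  define w where "w = (\<lambda>x. (p x + q x) / 2)"
  define S where "S = (\<lambda>x. (q x - p x) / (p x + q x))"
  have [measurable]: "w \<in> borel_measurable M" "S \<in> borel_measurable M"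
    unfolding w_def S_def by measurable
  have w_nonneg: "AE x in M. 0 \<le> w x" using nonneg by (auto simp: w_def)
  have wS: "p x = w x * (1 - S x)" "q x = w x * (1 + S x)" if "x \<in> space M" for x
  proof -
    have "p x + q x = 0 \<Longrightarrow> p x = 0 \<and> q x = 0" using nonneg[OF that] by simp
    then show "p x = w x * (1 - S x)" "q x = w x * (1 + S x)"
      by (cases "p x + q x = 0"; simp add: w_def S_def field_simps)+
  qed
  define N where "N = density M w"
  have w_int: "integrable M w" "integral\<^sup>L M w = 1" using int by (auto simp: w_def)
  have "emeasure N (space N) = ennreal 1"
    using w_int w_nonneg by (simp add: N_def emeasure_density nn_integral_eq_integral cong: nn_integral_cong)
  then interpret N: prob_space N by (intro prob_spaceI) simp
  \<comment> \<open>\<open>D\<close> contains the open interval and each endpoint at which both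
    integrands are finite.\<close>
  define D where "D = {s \<in> {-1..1}. persp_finite f (1 - s) (1 + s) \<and> persp_finite g (1 - s) (1 + s)}"
  define pf pg where "pf = (\<lambda>s. persp f (1 - s) (1 + s))" and "pg = (\<lambda>s. persp g (1 - s) (1 + s))"
  define h where "h = (\<lambda>s. Complex (pf s - x) (pg s - y))"
  have D_int: "{-1<..<1} \<subseteq> D" by (auto simp: D_def persp_finite_def)
  have convex_D: "convex D"
  proof -
    have "{a..b} \<subseteq> D" if "a \<in> D" "b \<in> D" for a b
    proof
      fix c assume "c \<in> {a..b}"
      moreover have "-1 \<le> a" "b \<le> 1" using that by (auto simp: D_def)
      ultimately have "c = a \<or> c = b \<or> c \<in> {-1<..<1}" by auto
      then show "c \<in> D" using that D_int by auto
    qed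
    then show ?thesis
      unfolding is_interval_convex_1[symmetric] is_interval_1 by (meson atLeastAtMost_iff subset_iff)
  qed
  have cont: "continuous_on D pf" "continuous_on D pg"
    unfolding pf_def pg_def
    by (auto intro: continuous_on_subset[OF persp_continuous[OF f]] continuous_on_subset[OF persp_continuous[OF g]]
        simp: D_def)
  have cont_h: "continuous_on D h"
    unfolding h_def Complex_eq by (intro continuous_intros cont)
  have S_range: "S x \<in> {-1..1}" if "x \<in> space M" for x
    using nonneg[OF that] by (cases "p x + q x = 0") (auto simp: S_def field_simps)
  have S_nonneg: "0 \<le> 1 - S x" "0 \<le> 1 + S x" if "x \<in> space M" for x
    using S_range[OF that] by auto
  have [measurable]: "(\<lambda>x. pf (S x)) \<in> borel_measurable M" "(\<lambda>x. pg (S x)) \<in> borel_measurable M"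
    unfolding pf_def pg_def by (intro persp_measurable f(1) g(1) S_nonneg; measurable)+
  have "w x * pf (S x) = persp f (p x) (q x)" "w x * pg (S x) = persp g (p x) (q x)" if "x \<in> space M" for x
    unfolding pf_def pg_def wS[OF that] persp_scale by simp_all
  then have wF: "integrable M (\<lambda>x. w x * pf (S x))" "(\<integral>x. w x * pf (S x) \<partial>M) = x"
    and wG: "integrable M (\<lambda>x. w x * pg (S x))" "(\<integral>x. w x * pg (S x) \<partial>M) = y"
    using F G by (simp_all cong: Bochner_Integration.integrable_cong Bochner_Integration.integral_cong)
  have w_S: "w x * S x = (q x - p x) / 2" if "x \<in> space M" for x
    unfolding wS[OF that] by (simp add: algebra_simps)
  have wS_int: "integrable M (\<lambda>x. w x * S x)" "(\<integral>x. w x * S x \<partial>M) = 0"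
  proof -
    have "integrable M (\<lambda>x. w x * S x) \<longleftrightarrow> integrable M (\<lambda>x. (q x - p x) / 2)"
      by (rule Bochner_Integration.integrable_cong[OF refl w_S])
    then show "integrable M (\<lambda>x. w x * S x)" using int by simp
    have "(\<integral>x. w x * S x \<partial>M) = (\<integral>x. (q x - p x) / 2 \<partial>M)"
      by (rule Bochner_Integration.integral_cong[OF refl w_S])
    then show "(\<integral>x. w x * S x \<partial>M) = 0" using int by simp
  qed
  have N_int: "integrable N r \<longleftrightarrow> integrable M (\<lambda>x. w x * r x)"
    "N.expectation r = (\<integral>x. w x * r x \<partial>M)"
    if "r \<in> borel_measurable M" for r :: "'a \<Rightarrow> real"
  proof -
    show "integrable N r \<longleftrightarrow> integrable M (\<lambda>x. w x * r x)"
      unfolding N_def by (rule integrable_real_density) (use that w_nonneg in simp_all)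
    show "N.expectation r = (\<integral>x. w x * r x \<partial>M)"
      unfolding N_def by (rule integral_real_density) (use that w_nonneg in simp_all)
  qed
  have S_int: "integrable N S" "N.expectation S = 0"
    and pf_int: "integrable N (\<lambda>x. pf (S x))" "N.expectation (\<lambda>x. pf (S x)) = x"
    and pg_int: "integrable N (\<lambda>x. pg (S x))" "N.expectation (\<lambda>x. pg (S x)) = y"
    using wF wG wS_int by (simp_all add: N_int)
  have h_int: "integrable N (\<lambda>x. h (S x))" "N.expectation (\<lambda>x. h (S x)) = 0"
    using pf_int pg_int unfolding h_def Complex_eq by (simp_all add: N.prob_space)
  \<comment> \<open>Finiteness passes from \<open>(p, q)\<close> to \<open>(1 - S, 1 + S)\<close>
    only through a nonzero factor \<open>w\<close>; the set \<open>w = 0\<close> is null for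
    \<open>N\<close>.\<close>
  have "AE x in M. 0 < ennreal (w x) \<longrightarrow> S x \<in> D"
    using F(1) G(1) AE_space
  proof eventually_elim
    case (elim x)
    then show ?case
      using S_range[OF elim(3)] unfolding wS[OF elim(3)] by (auto simp: D_def persp_finite_scale)
  qed
  then have S_D: "AE x in N. S x \<in> D" unfolding N_def by (subst AE_density) auto
  have "0 < (1/2 :: real)" "1/2 \<in> D" using D_int by auto
  from N.zero_on_segment_of_chords[OF convex_D this(2,1) cont_h S_int S_D h_int]
  obtain a b a' b' where in_D: "a \<in> D" "b \<in> D" "a' \<in> D" "b' \<in> D"
    and ab: "a \<le> 0" "0 \<le> b" "a < b" and ab': "a' \<le> 0" "0 \<le> b'" "a' < b'"
    and seg: "0 \<in> closed_segment (chord_at_0 h a b) (chord_at_0 h a' b')"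
    by auto
  obtain t where t: "0 \<le> t" "t \<le> 1"
    and zero: "(1 - t) *\<^sub>R chord_at_0 h a b + t *\<^sub>R chord_at_0 h a' b' = 0"
    using seg by (auto simp: closed_segment_def)
  have one: "b / (b - a) + - a / (b - a) = 1" if "a < b" for a b :: real
    using that unfolding add_divide_distrib[symmetric] by simp
  have weight_nonneg: "0 \<le> b / (b - a)" "0 \<le> - a / (b - a)" if "a \<le> 0" "0 \<le> b" "a < b" for a b :: real
    using that by (intro divide_nonneg_pos; simp)+
  have chord_h: "chord_at_0 h a b = Complex (chord_at_0 pf a b - x) (chord_at_0 pg a b - y)"
    if "a < b" for a b
  proof -
    \<comment> \<open>The chord weights sum to 1, so subtracting the target commutes with taking
      chords.\<close>
    have "\<alpha> * (u - c) + \<beta> * (v - c) = \<alpha> * u + \<beta> * v - (\<alpha> + \<beta>) * c" for \<alpha> \<beta> u v c :: real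
      by (simp add: algebra_simps)
    from this[of "b / (b - a)" _ _ "- a / (b - a)", unfolded one[OF that]] show ?thesis
      unfolding chord_at_0_def h_def by (intro complex_eqI) (simp_all only: plus_complex.sel scaleR_complex.sel complex.sel real_scaleR_def mult_1)
  qed
  have x: "x = t * chord_at_0 pf a' b' + (1 - t) * chord_at_0 pf a b"
    and y: "y = t * chord_at_0 pg a' b' + (1 - t) * chord_at_0 pg a b"
    using zero unfolding chord_h[OF ab(3)] chord_h[OF ab'(3)] complex_eq_iff
    by (simp_all add: algebra_simps)
  have "d_achievable 2 f g (chord_at_0 pf a b) (chord_at_0 pg a b)"
    if "a \<in> D" "b \<in> D" "a \<le> 0" "0 \<le> b" "a < b" for a b
  proof -
    let ?w = "(!) [b / (b - a), - a / (b - a)]" and ?s = "(!) [a, b]"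
    have w: "0 \<le> ?w i" and s: "?s i \<in> D" if "i < 2" for i
      using that \<open>a \<in> D\<close> \<open>b \<in> D\<close> weight_nonneg[of a b] \<open>a \<le> 0\<close> \<open>0 \<le> b\<close> \<open>a < b\<close>
      by (auto simp: less_2_cases_iff)
    have "d_achievable 2 f g (\<Sum>i<2. ?w i * persp f (1 - ?s i) (1 + ?s i))
      (\<Sum>i<2. ?w i * persp g (1 - ?s i) (1 + ?s i))"
    proof (rule d_achievable_weights[OF f(1) g(1)])
      show "(\<Sum>i<2. ?w i) = 1" "(\<Sum>i<2. ?w i * ?s i) = 0"
        using one[OF that(5)] by (simp_all add: numeral_2_eq_2)
    qed (use w s in \<open>simp_all add: D_def\<close>)
    then show ?thesis by (simp add: numeral_2_eq_2 chord_at_0_def pf_def pg_def)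
  qed
  note two = this[OF in_D(1,2) ab] this[OF in_D(3,4) ab']
  have "d_achievable 4 f g x y"
  proof -
    \<comment> \<open>The two binary laws are placed on disjoint pairs of indices and scaled by
      \<open>t\<close> and \<open>1 - t\<close>; each has mean 0, hence so does the mixture.\<close>
    let ?w = "(!) [t * (b' / (b' - a')), t * (- a' / (b' - a')), (1 - t) * (b / (b - a)), (1 - t) * (- a / (b - a))]"
      and ?s = "(!) [a', b', a, b]"
    have w: "0 \<le> ?w i" and s: "?s i \<in> D" if "i < 4" for i
    proof -
      have "i = 0 \<or> i = 1 \<or> i = 2 \<or> i = 3" using that by linarith
      moreover have "0 \<le> t * (b' / (b' - a'))" "0 \<le> t * (- a' / (b' - a'))"
        "0 \<le> (1 - t) * (b / (b - a))" "0 \<le> (1 - t) * (- a / (b - a))"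
        using weight_nonneg[OF ab] weight_nonneg[OF ab'] t by (intro mult_nonneg_nonneg; simp)+
      ultimately show "0 \<le> ?w i" "?s i \<in> D" using in_D by (elim disjE; simp)+
    qed
    have expand: "(\<Sum>i<4. r i) = r 0 + r 1 + r 2 + r 3" for r :: "nat \<Rightarrow> real"
      by (simp add: eval_nat_numeral)
    have "d_achievable 4 f g (\<Sum>i<4. ?w i * persp f (1 - ?s i) (1 + ?s i))
      (\<Sum>i<4. ?w i * persp g (1 - ?s i) (1 + ?s i))"
    proof (rule d_achievable_weights[OF f(1) g(1)])
      have "(\<Sum>i<4. ?w i) = t * (b' / (b' - a') + - a' / (b' - a')) + (1 - t) * (b / (b - a) + - a / (b - a))"
        unfolding expand distrib_left by simp
      then show "(\<Sum>i<4. ?w i) = 1"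
        unfolding one[OF ab(3)] one[OF ab'(3)] by simp
      show "(\<Sum>i<4. ?w i * ?s i) = 0" unfolding expand by simp
    qed (use w s in \<open>simp_all add: D_def\<close>)
    moreover have "(\<Sum>i<4. ?w i * persp f (1 - ?s i) (1 + ?s i)) = x"
      "(\<Sum>i<4. ?w i * persp g (1 - ?s i) (1 + ?s i)) = y"
      unfolding expand x y chord_at_0_def pf_def pg_def by (simp_all add: distrib_left right_diff_distrib)
    ultimately show ?thesis by simp
  qed
  then show ?thesis using two t x y by blast
qed

end
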